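(* There exist absolute constants $c,c_0>0$ such that for all integers $N\ge 1$, $T\ge 2$ and every $Z$ with $0<Z\le c_0(NT)^{-2}$ there is an online algorithm which at each time $t$ plays a convex combination $p_t$ of $N$ strategies $S_1,\ldots,S_N$ (depending only on payoffs up to time $t-1$), with payoff $s_{*,t}=\sum_ip_{i,t}s_{i,t}$, such that for every payoff sequence $s_{i,t}\in[-1,1]$ and every $1\le i\le N$ the sequence $(s_{i,t}-s_{*,t})_{t=1}^T$ is $Z$-uniform at every scale $\rho=1-1/n$ with $n\ge 40\log(1/Z)$; that is, for all such $n$ and all $1\le t\le T$, $$\sum_{j=1}^t\left(1-\tfrac1n\right)^{t-j}\left(s_{i,j}-s_{*,j}\right)\ \le\ c\sqrt{n\log(1/Z)}.$$
   Context: Experts problem with full information: $N$ strategies have adversarial payoffs $s_{i,t}\in[-1,1]$, $t=1,\ldots,T$; at time $t$ the algorithm chooses weights $p_t$ in the probability simplex before the payoffs at time $t$ are revealed. A real sequence $(r_t)$ is called $Z$-uniform at scale $\rho=1-1/n$ if $\sum_{j=1}^t\rho^{t-j}r_j\le c\sqrt{n\log(1/Z)}$ for all $t$, for a constant $c>0$. *)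

theory Defs
  imports Complex_Main
begin

text \<open>Strategies are indexed by \<open>1..N\<close> and times by \<open>1..T\<close>; \<open>s i t\<close> is the payoff of strategy \<open>i\<close>
  at time \<open>t\<close>. Values outside these ranges are never consulted.\<close>

definition payoff_seq :: "nat \<Rightarrow> nat \<Rightarrow> (nat \<Rightarrow> nat \<Rightarrow> real) \<Rightarrow> bool" where
  "payoff_seq N T s \<longleftrightarrow> (\<forall>i\<in>{1..N}. \<forall>t\<in>{1..T}. - 1 \<le> s i t \<and> s i t \<le> 1)"

definition prob_weights :: "nat \<Rightarrow> (nat \<Rightarrow> real) \<Rightarrow> bool" where
  "prob_weights N w \<longleftrightarrow> (\<forall>i\<in>{1..N}. 0 \<le> w i) \<and> (\<Sum>i=1..N. w i) = 1"

text \<open>An algorithm is a map \<open>A\<close> from whole payoff sequences to weights, \<open>A s t i\<close> being the weight of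
  strategy \<open>i\<close> at time \<open>t\<close>. Being online is the second conjunct: if two payoff sequences agree at
  all times \<open>j < t\<close>, the weights at time \<open>t\<close> agree.\<close>

definition online_algorithm ::
  "nat \<Rightarrow> nat \<Rightarrow> ((nat \<Rightarrow> nat \<Rightarrow> real) \<Rightarrow> nat \<Rightarrow> nat \<Rightarrow> real) \<Rightarrow> bool" where
  "online_algorithm N T A \<longleftrightarrow>
     (\<forall>s. payoff_seq N T s \<longrightarrow> (\<forall>t\<in>{1..T}. prob_weights N (A s t))) \<and>
     (\<forall>s s'. payoff_seq N T s \<longrightarrow> payoff_seq N T s' \<longrightarrow>
        (\<forall>t\<in>{1..T}. (\<forall>i\<in>{1..N}. \<forall>j\<in>{1..<t}. s i j = s' i j) \<longrightarrow>
           (\<forall>i\<in>{1..N}. A s t i = A s' t i)))"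

definition alg_payoff :: "nat \<Rightarrow> (nat \<Rightarrow> nat \<Rightarrow> real) \<Rightarrow> (nat \<Rightarrow> nat \<Rightarrow> real) \<Rightarrow> nat \<Rightarrow> real" where
  "alg_payoff N p s t = (\<Sum>i=1..N. p t i * s i t)"

text \<open>\<open>Z\<close>-uniformity with constant \<open>c\<close> at scale \<open>1 - 1/n\<close>, for a sequence indexed by \<open>1..T\<close>.
  The parameter \<open>n\<close> is real, not necessarily an integer.\<close>

definition Z_uniform :: "real \<Rightarrow> real \<Rightarrow> real \<Rightarrow> nat \<Rightarrow> (nat \<Rightarrow> real) \<Rightarrow> bool" where
  "Z_uniform c Z n T r \<longleftrightarrow>
     (\<forall>t\<in>{1..T}. (\<Sum>j=1..t. (1 - 1 / n) ^ (t - j) * r j) \<le> c * sqrt (n * ln (1 / Z)))"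

end

theory Submission
  imports Defs
begin

text \<open>Run multiplicative weights over specialists: there is one specialist for each strategy and each
  interval \<open>[a, b]\<close>, active only inside its interval, with a learning rate of order
  \<open>sqrt (ln (1/Z) / (b - a + 1))\<close>. Mixing the strategies in proportion to rate times weight of
  the active specialists keeps the total weight constant, so no weight exceeds the number of
  specialists. Hence the regret is \<open>O(sqrt (m ln (1/Z)))\<close> on every interval of length \<open>m\<close> at once.
  A discounted sum is an average of sums over final segments, of mean length at most \<open>n\<close>, so
  concavity of the square root yields the bound at every scale.\<close>

section \<open>Multiplicative weights over sleeping specialists\<close>

definition play :: "nat \<Rightarrow> 'k set \<Rightarrow> ('k \<Rightarrow> real) \<Rightarrow> (nat \<Rightarrow> 'k \<Rightarrow> real) \<Rightarrow> nat \<Rightarrow> real" where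
  "play N K h v i = (\<Sum>k\<in>K. h k * v i k) / (\<Sum>i'=1..N. \<Sum>k\<in>K. h k * v i' k)"

text \<open>A learning rate \<open>h t k = 0\<close> encodes that the specialist \<open>k\<close> is asleep at time \<open>t\<close>.\<close>

primrec spec_weight ::
  "nat \<Rightarrow> 'k set \<Rightarrow> (nat \<Rightarrow> 'k \<Rightarrow> real) \<Rightarrow> (nat \<Rightarrow> nat \<Rightarrow> real) \<Rightarrow> nat \<Rightarrow> nat \<Rightarrow> 'k \<Rightarrow> real" where
  "spec_weight N K h s 0 = (\<lambda>i k. 1)"
| "spec_weight N K h s (Suc t) = (\<lambda>i k. spec_weight N K h s t i k *
     (1 + h (Suc t) k * (s i (Suc t) -
       alg_payoff N (\<lambda>_. play N K (h (Suc t)) (spec_weight N K h s t)) s (Suc t))))"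

text \<open>The index \<open>t - 1\<close> makes the algorithm online: the weights after
  \<open>t - 1\<close> updates have consulted payoffs up to time \<open>t - 1\<close> only. A
  specialist is a pair of a strategy \<open>i\<close> and an index \<open>k\<close> in
  \<open>K\<close>, and its rate depends on \<open>k\<close> alone.\<close>

definition spec_alg ::
  "nat \<Rightarrow> 'k set \<Rightarrow> (nat \<Rightarrow> 'k \<Rightarrow> real) \<Rightarrow> (nat \<Rightarrow> nat \<Rightarrow> real) \<Rightarrow> nat \<Rightarrow> nat \<Rightarrow> real" where
  "spec_alg N K h s t = play N K (h t) (spec_weight N K h s (t - 1))"

text \<open>Needed so that \<open>play\<close> is a genuine probability vector: were everybody
  asleep, division by zero would turn it into the zero vector. This is why later lemmas ask for an
  awake specialist at each time.\<close>

lemma play_denom_pos: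
  fixes h :: "'k \<Rightarrow> real" and v :: "nat \<Rightarrow> 'k \<Rightarrow> real"
  assumes "N \<ge> 1" "finite K" "\<And>k. k \<in> K \<Longrightarrow> 0 \<le> h k" "\<exists>k\<in>K. 0 < h k"
    and "\<And>i k. i \<in> {1..N} \<Longrightarrow> k \<in> K \<Longrightarrow> 0 < v i k"
  shows "0 < (\<Sum>i=1..N. \<Sum>k\<in>K. h k * v i k)"
proof (rule sum_pos)
  fix i assume i: "i \<in> {1..N}"
  obtain k where k: "k \<in> K" "0 < h k" using assms(4) by blast
  show "0 < (\<Sum>k\<in>K. h k * v i k)"
    by (rule sum_pos2[of K k]) (use assms i k in \<open>auto simp: less_imp_le\<close>)
qed (use assms in auto)

lemma play_prob_weights:
  assumes "N \<ge> 1" "finite K" "\<And>k. k \<in> K \<Longrightarrow> 0 \<le> h k" "\<exists>k\<in>K. 0 < h k"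
    and "\<And>i k. i \<in> {1..N} \<Longrightarrow> k \<in> K \<Longrightarrow> 0 < v i k"
  shows "prob_weights N (play N K h v)"
proof -
  have pos: "0 < (\<Sum>i=1..N. \<Sum>k\<in>K. h k * v i k)" by (rule play_denom_pos) (use assms in auto)
  have "0 \<le> (\<Sum>k\<in>K. h k * v i k)" if "i \<in> {1..N}" for i
    by (rule sum_nonneg) (use assms that in \<open>auto simp: less_imp_le\<close>)
  then show ?thesis
    using pos by (auto simp: prob_weights_def play_def sum_divide_distrib[symmetric])
qed

lemma alg_payoff_bounds:
  assumes "prob_weights N (p t)" "\<And>i. i \<in> {1..N} \<Longrightarrow> \<bar>s i t\<bar> \<le> 1"
  shows "\<bar>alg_payoff N p s t\<bar> \<le> 1"
proof -
  have "\<bar>alg_payoff N p s t\<bar> \<le> (\<Sum>i=1..N. \<bar>p t i * s i t\<bar>)"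
    unfolding alg_payoff_def by (rule sum_abs)
  also have "\<dots> \<le> (\<Sum>i=1..N. p t i)"
    by (rule sum_mono) (use assms in \<open>auto simp: abs_mult prob_weights_def intro!: mult_left_le\<close>)
  also have "\<dots> = 1" using assms(1) by (simp add: prob_weights_def)
  finally show ?thesis .
qed

text \<open>The algorithm's payoff is the mean of the \<open>s i t\<close> with weights
  \<open>?g i\<close>, and deviations from a weighted mean cancel. As the update is linear in these
  deviations, the total weight is conserved exactly, without any second-order loss.\<close>

lemma play_balance:
  assumes "(\<Sum>i=1..N. \<Sum>k\<in>K. h k * v i k) \<noteq> 0"
  shows "(\<Sum>i=1..N. \<Sum>k\<in>K. v i k * (h k * (s i t - alg_payoff N (\<lambda>_. play N K h v) s t))) = 0"
proof -
  let ?g = "\<lambda>i. \<Sum>k\<in>K. h k * v i k"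
  let ?D = "\<Sum>i=1..N. ?g i"
  let ?a = "alg_payoff N (\<lambda>_. play N K h v) s t"
  have "?a = (\<Sum>i=1..N. ?g i * s i t) / ?D"
    by (simp add: alg_payoff_def play_def sum_divide_distrib[of "\<lambda>i. ?g i * s i t"])
  then have a: "?D * ?a = (\<Sum>i=1..N. ?g i * s i t)" using assms by simp
  have "(\<Sum>i=1..N. \<Sum>k\<in>K. v i k * (h k * (s i t - ?a))) = (\<Sum>i=1..N. ?g i * (s i t - ?a))"
    by (simp add: sum_distrib_right mult_ac)
  also have "\<dots> = (\<Sum>i=1..N. ?g i * s i t) - ?D * ?a"
    by (simp add: right_diff_distrib sum_subtractf sum_distrib_right)
  finally show ?thesis using a by simp
qed

lemma spec_weight_cong:
  assumes "\<forall>i\<in>{1..N}. \<forall>j\<in>{1..t}. s i j = s' i j" "i \<in> {1..N}"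
  shows "spec_weight N K h s t i = spec_weight N K h s' t i"
  using assms
proof (induction t arbitrary: i)
  case (Suc t)
  then have IH: "\<And>j. j \<in> {1..N} \<Longrightarrow> spec_weight N K h s t j = spec_weight N K h s' t j" by auto
  have "play N K (h (Suc t)) (spec_weight N K h s t) j = play N K (h (Suc t)) (spec_weight N K h s' t) j"
    if "j \<in> {1..N}" for j
    unfolding play_def using IH that by (intro arg_cong2[where f = "(/)"] sum.cong) auto
  then have "alg_payoff N (\<lambda>_. play N K (h (Suc t)) (spec_weight N K h s t)) s (Suc t) =
      alg_payoff N (\<lambda>_. play N K (h (Suc t)) (spec_weight N K h s' t)) s' (Suc t)"
    unfolding alg_payoff_def using Suc.prems by (intro sum.cong) auto
  then show ?case using IH Suc.prems by auto
qed simp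

text \<open>Rates at most 1/4 and deviations of at least -2 keep every factor at least 1/2.
  Positivity and the total are proved in one induction because the balance at each step needs a
  nonzero denominator, which comes from positive weights.\<close>

lemma spec_weight_invariant:
  assumes "N \<ge> 1" "finite K"
    and h: "\<And>t k. t \<in> {1..T} \<Longrightarrow> k \<in> K \<Longrightarrow> 0 \<le> h t k \<and> h t k \<le> 1/4"
    and ex: "\<And>t. t \<in> {1..T} \<Longrightarrow> \<exists>k\<in>K. 0 < h t k"
    and s: "payoff_seq N T s" and "t \<le> T"
  shows "(\<forall>i\<in>{1..N}. \<forall>k\<in>K. 0 < spec_weight N K h s t i k) \<and>
    (\<Sum>i=1..N. \<Sum>k\<in>K. spec_weight N K h s t i k) = real (N * card K)"
  using \<open>t \<le> T\<close>
proof (induction t)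
  case (Suc t)
  define v where "v = spec_weight N K h s t"
  define r where "r = (\<lambda>i. s i (Suc t) - alg_payoff N (\<lambda>_. play N K (h (Suc t)) v) s (Suc t))"
  have t: "Suc t \<in> {1..T}" using Suc.prems by simp
  have pos: "\<And>i k. i \<in> {1..N} \<Longrightarrow> k \<in> K \<Longrightarrow> 0 < v i k"
    and tot: "(\<Sum>i=1..N. \<Sum>k\<in>K. v i k) = real (N * card K)"
    using Suc unfolding v_def by auto
  have pw: "prob_weights N (play N K (h (Suc t)) v)"
    by (rule play_prob_weights) (use assms t pos in auto)
  have s1: "\<bar>s i (Suc t)\<bar> \<le> 1" if "i \<in> {1..N}" for i
    using s t that by (auto simp: payoff_seq_def abs_le_iff minus_le_iff)
  have "\<bar>alg_payoff N (\<lambda>_. play N K (h (Suc t)) v) s (Suc t)\<bar> \<le> 1"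
    by (rule alg_payoff_bounds) (use pw s1 in auto)
  then have r: "- 2 \<le> r i" if "i \<in> {1..N}" for i
    using s1[OF that] unfolding r_def by linarith
  have fac: "0 < 1 + h (Suc t) k * r i" if "i \<in> {1..N}" "k \<in> K" for i k
  proof -
    have "h (Suc t) k * (- 2) \<le> h (Suc t) k * r i"
      using h[OF t that(2)] r[OF that(1)] by (intro mult_left_mono) auto
    then show ?thesis using h[OF t that(2)] by linarith
  qed
  have eq: "spec_weight N K h s (Suc t) = (\<lambda>i k. v i k * (1 + h (Suc t) k * r i))"
    by (simp add: v_def r_def)
  have "0 < (\<Sum>i=1..N. \<Sum>k\<in>K. h (Suc t) k * v i k)"
    by (rule play_denom_pos) (use assms t pos in auto)
  then have "(\<Sum>i=1..N. \<Sum>k\<in>K. v i k * (h (Suc t) k * r i)) = 0"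
    unfolding r_def by (intro play_balance) simp
  then show ?case
    unfolding eq using mult_pos_pos[OF pos fac] tot by (auto simp: distrib_left sum.distrib)
qed simp

lemma spec_weight_eq_prod:
  "spec_weight N K h s t i k =
    (\<Prod>j=1..t. 1 + h j k * (s i j - alg_payoff N (spec_alg N K h s) s j))"
proof (induction t)
  case (Suc t)
  then show ?case by (simp add: spec_alg_def alg_payoff_def)
qed simp

lemma spec_weight_le:
  assumes "finite K" "\<forall>i\<in>{1..N}. \<forall>k\<in>K. 0 < spec_weight N K h s t i k"
    and "(\<Sum>i=1..N. \<Sum>k\<in>K. spec_weight N K h s t i k) = C"
    and "i \<in> {1..N}" "k \<in> K"
  shows "spec_weight N K h s t i k \<le> C"
proof -
  have "spec_weight N K h s t i k \<le> (\<Sum>k\<in>K. spec_weight N K h s t i k)"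
    using assms by (intro member_le_sum) (auto intro: less_imp_le)
  also have "\<dots> \<le> (\<Sum>i=1..N. \<Sum>k\<in>K. spec_weight N K h s t i k)"
    using assms by (intro member_le_sum[where f = "\<lambda>i. \<Sum>k\<in>K. spec_weight N K h s t i k"])
      (auto intro!: sum_nonneg simp: less_imp_le)
  finally show ?thesis using assms(3) by simp
qed

lemma spec_alg_online:
  assumes "N \<ge> 1" "finite K"
    and h: "\<And>t k. t \<in> {1..T} \<Longrightarrow> k \<in> K \<Longrightarrow> 0 \<le> h t k \<and> h t k \<le> 1/4"
    and ex: "\<And>t. t \<in> {1..T} \<Longrightarrow> \<exists>k\<in>K. 0 < h t k"
  shows "online_algorithm N T (spec_alg N K h)"
  unfolding online_algorithm_def
proof (intro conjI allI impI ballI)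
  fix s t assume s: "payoff_seq N T s" and t: "t \<in> {1..T}"
  then have "t - 1 \<le> T" by auto
  from spec_weight_invariant[OF assms s this] show "prob_weights N (spec_alg N K h s t)"
    unfolding spec_alg_def by (intro play_prob_weights) (use assms t in auto)
next
  fix s s' :: "nat \<Rightarrow> nat \<Rightarrow> real" and t i
  assume t: "t \<in> {1..T}" and eq: "\<forall>i\<in>{1..N}. \<forall>j\<in>{1..<t}. s i j = s' i j" and i: "i \<in> {1..N}"
  have eq': "\<forall>i\<in>{1..N}. \<forall>j\<in>{1..t - 1}. s i j = s' i j" using eq t by auto
  have "spec_weight N K h s (t - 1) j = spec_weight N K h s' (t - 1) j" if "j \<in> {1..N}" for j
    using eq' that by (rule spec_weight_cong)
  then show "spec_alg N K h s t i = spec_alg N K h s' t i"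
    unfolding spec_alg_def play_def using i
    by (intro arg_cong2[where f = "(/)"] sum.cong) auto
qed

section \<open>From a bound on a weight to a bound on regret\<close>

lemma regret_le_of_prod_le:
  fixes r :: "nat \<Rightarrow> real"
  assumes "finite I" "\<And>j. j \<in> I \<Longrightarrow> \<bar>r j\<bar> \<le> 2" "0 < \<eta>" "\<eta> \<le> 1/4"
    and "(\<Prod>j\<in>I. 1 + \<eta> * r j) \<le> C"
  shows "(\<Sum>j\<in>I. r j) \<le> ln C / \<eta> + 8 * \<eta> * card I"
proof -
  have *: "\<bar>\<eta> * r j\<bar> \<le> 1/2" if "j \<in> I" for j
  proof -
    have "\<eta> * \<bar>r j\<bar> \<le> 1/4 * 2" using assms that by (intro mult_mono) auto
    then show ?thesis using assms(3) by (simp add: abs_mult)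
  qed
  have pos: "0 < 1 + \<eta> * r j" if "j \<in> I" for j using *[OF that] by linarith
  have P: "0 < (\<Prod>j\<in>I. 1 + \<eta> * r j)" using pos by (rule prod_pos)
  \<comment> \<open>Second-order bound ln (1 + x) \<ge> x - 2 x^2 for |x| \<le> 1/2, at x =
    \<open>\<eta> * r j\<close>; with |\<open>r j\<close>| \<le> 2 the error is at most 2 * 4 = 8
    times the square of \<open>\<eta>\<close>.\<close>
  have "\<eta> * r j - 8 * \<eta>\<^sup>2 \<le> ln (1 + \<eta> * r j)" if "j \<in> I" for j
  proof -
    have "(r j)\<^sup>2 \<le> 2\<^sup>2" using assms(2)[OF that] by (metis abs_ge_zero power2_abs power_mono)
    then have "(\<eta> * r j)\<^sup>2 \<le> \<eta>\<^sup>2 * 4"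
      by (simp add: power_mult_distrib mult_left_mono)
    moreover have "\<bar>ln (1 + \<eta> * r j) - \<eta> * r j\<bar> \<le> 2 * (\<eta> * r j)\<^sup>2"
      using *[OF that] by (rule abs_ln_one_plus_x_minus_x_bound)
    ultimately show ?thesis by linarith
  qed
  then have "(\<Sum>j\<in>I. \<eta> * r j - 8 * \<eta>\<^sup>2) \<le> (\<Sum>j\<in>I. ln (1 + \<eta> * r j))" by (rule sum_mono)
  also have "\<dots> = ln (\<Prod>j\<in>I. 1 + \<eta> * r j)" using pos assms(1) by (subst ln_prod) force+
  also have "\<dots> \<le> ln C" using P assms(5) by simp
  finally have "\<eta> * (\<Sum>j\<in>I. r j) \<le> ln C + 8 * \<eta>\<^sup>2 * card I"
    by (simp add: sum_subtractf sum_distrib_left mult.commute)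
  then show ?thesis using assms(3) by (simp add: field_simps power2_eq_square)
qed

section \<open>Discounted sums controlled by sums over final segments\<close>

lemma discounted_sum_le:
  fixes x :: "nat \<Rightarrow> real"
  assumes "0 \<le> \<rho>" "\<rho> \<le> 1" "0 \<le> \<alpha>"
    and prefix: "\<And>l. l \<le> m \<Longrightarrow> (\<Sum>k<l. x k) \<le> \<alpha>"
  shows "(\<Sum>k<m. \<rho> ^ k * x k) \<le> \<alpha>"
proof -
  \<comment> \<open>Abel summation as an induction: the current prefix sum is kept with its weight
    \<open>\<rho> ^ l\<close>, and each step replaces only the share
    \<open>\<rho> ^ l * (1 - \<rho>)\<close> of it by \<open>\<alpha>\<close>. All these shares are
    nonnegative and add up to one.\<close>
  have "(\<Sum>k<l. \<rho> ^ k * x k) \<le> \<alpha> * (1 - \<rho> ^ l) + \<rho> ^ l * (\<Sum>k<l. x k)" if "l \<le> m" for l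
    using that
  proof (induction l)
    case (Suc l)
    let ?S = "\<Sum>k<Suc l. x k"
    have "(\<rho> ^ l * (1 - \<rho>)) * ?S \<le> (\<rho> ^ l * (1 - \<rho>)) * \<alpha>"
      using assms Suc.prems by (intro mult_left_mono prefix) auto
    then show ?case using Suc by (simp add: algebra_simps)
  qed simp
  from this[of m] have "(\<Sum>k<m. \<rho> ^ k * x k) \<le> \<alpha> * (1 - \<rho> ^ m) + \<rho> ^ m * (\<Sum>k<m. x k)" by simp
  also have "\<dots> \<le> \<alpha> * (1 - \<rho> ^ m) + \<rho> ^ m * \<alpha>"
    using prefix[of m] assms by (intro add_left_mono mult_left_mono) auto
  also have "\<dots> = \<alpha>" by (simp add: algebra_simps)
  finally show ?thesis .
qed

lemma geometric_sum_le:
  fixes n :: real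
  assumes "n \<ge> 1"
  shows "(\<Sum>k<m. (1 - 1/n) ^ k) \<le> n"
proof -
  have "(1 - (1 - 1/n)) * (\<Sum>k<m. (1 - 1/n) ^ k) = 1 - (1 - 1/n) ^ m"
    by (simp only: one_diff_power_eq)
  also have "\<dots> \<le> 1" using assms by simp
  finally show ?thesis using assms by (simp add: field_simps)
qed

text \<open>The square root is replaced by its tangent line at length \<open>n\<close>. The constant
  part passes through the discounting unchanged, and the linear part costs its slope times the total
  discount, at most \<open>n\<close>. Each contributes half of the bound, so \<open>C\<close> is not
  worsened.\<close>

lemma discounted_sum_sqrt_le:
  fixes r :: "nat \<Rightarrow> real"
  assumes "n \<ge> 1" "0 \<le> L" "0 \<le> C"
    and seg: "\<And>a. a \<in> {1..t} \<Longrightarrow> (\<Sum>j=a..t. r j) \<le> C * sqrt (real (t - a + 1) * L)"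
  shows "(\<Sum>j=1..t. (1 - 1/n) ^ (t - j) * r j) \<le> C * sqrt (n * L)"
proof -
  \<comment> \<open>By AM-GM, \<open>C * sqrt (l * L) \<le> \<alpha> + \<beta> * l\<close>, with equality at \<open>l = n\<close>.\<close>
  define \<alpha> where "\<alpha> = C * sqrt (n * L) / 2"
  define \<beta> where "\<beta> = C * sqrt (n * L) / (2 * n)"
  have nn: "0 \<le> \<alpha>" "0 \<le> \<beta>" using assms by (auto simp: \<alpha>_def \<beta>_def)
  \<comment> \<open>Time runs backwards from \<open>t\<close>, so prefix sums of \<open>x\<close>
    are sums over final segments; subtracting the slope makes their bound independent of the
    length.\<close>
  define x where "x k = r (t - k) - \<beta>" for k
  have prefix: "(\<Sum>k<l. x k) \<le> \<alpha>" if l: "l \<le> t" for l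
  proof (cases "l = 0")
    case False
    have "(\<Sum>k<l. r (t - k)) = (\<Sum>j=t + 1 - l..t. r j)"
      by (rule sum.reindex_bij_witness[of _ "\<lambda>j. t - j" "\<lambda>k. t - k"]) (use l in auto)
    also have "\<dots> \<le> C * sqrt (real l * L)"
      using seg[of "t + 1 - l"] l False by (auto simp: Suc_diff_le)
    also have "\<dots> \<le> \<alpha> + \<beta> * l"
    proof -
      have "sqrt (real l * n) \<le> (real l + n) / 2"
        using assms by (intro arith_geo_mean_sqrt) auto
      then have "sqrt (real l) \<le> (real l + n) / (2 * sqrt n)"
        using assms by (simp add: real_sqrt_mult field_simps)
      also have "\<dots> = sqrt n / 2 + sqrt n / (2 * n) * l"
      proof -
        have "n = sqrt n * sqrt n" using assms by simp
        then show ?thesis using assms by (simp add: divide_simps) (simp add: algebra_simps)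
      qed
      finally have "C * sqrt L * sqrt (real l) \<le> C * sqrt L * (sqrt n / 2 + sqrt n / (2 * n) * l)"
        using assms by (intro mult_left_mono) auto
      then show ?thesis by (simp add: \<alpha>_def \<beta>_def real_sqrt_mult algebra_simps)
    qed
    finally show ?thesis by (simp add: x_def sum_subtractf mult.commute)
  qed (use nn in simp)
  have "(\<Sum>j=1..t. (1 - 1/n) ^ (t - j) * r j) = (\<Sum>k<t. (1 - 1/n) ^ k * r (t - k))"
    by (rule sum.reindex_bij_witness[of _ "\<lambda>k. t - k" "\<lambda>j. t - j"]) auto
  also have "\<dots> = (\<Sum>k<t. (1 - 1/n) ^ k * x k) + \<beta> * (\<Sum>k<t. (1 - 1/n) ^ k)"
    by (simp add: x_def algebra_simps sum.distrib sum_subtractf sum_distrib_left)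
  also have "\<dots> \<le> \<alpha> + \<beta> * n"
    using assms nn prefix
    by (intro add_mono mult_left_mono discounted_sum_le geometric_sum_le) auto
  also have "\<dots> = C * sqrt (n * L)" using assms by (simp add: \<alpha>_def \<beta>_def)
  finally show ?thesis .
qed

section \<open>Specialists attached to time intervals\<close>

text \<open>The square root balances the two regret terms \<open>L / \<eta>\<close> and
  \<open>8 * \<eta> * m\<close> for length \<open>m\<close> up to a constant; the cap and the factor
  1/4 keep weights positive. For a > b truncated subtraction gives length 1, so the rate is still
  positive, but such a pair is never awake.\<close>

definition interval_rate :: "real \<Rightarrow> nat \<times> nat \<Rightarrow> real" where
  "interval_rate L = (\<lambda>(a, b). min 1 (sqrt (L / real (b - a + 1))) / 4)"

definition active_rate :: "real \<Rightarrow> nat \<Rightarrow> nat \<times> nat \<Rightarrow> real" where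
  "active_rate L t k = (if t \<in> {fst k..snd k} then interval_rate L k else 0)"

lemma interval_rate_bounds: "0 < L \<Longrightarrow> 0 < interval_rate L k \<and> interval_rate L k \<le> 1/4"
  by (cases k) (auto simp: interval_rate_def min_def)

lemma active_rate_bounds: "0 < L \<Longrightarrow> 0 \<le> active_rate L t k \<and> active_rate L t k \<le> 1/4"
  using interval_rate_bounds by (auto simp: active_rate_def less_imp_le)

lemma ex_active_rate_pos:
  assumes "0 < L" "t \<in> {1..T}"
  shows "\<exists>k\<in>{1..T} \<times> {1..T}. 0 < active_rate L t k"
  \<comment> \<open>The one-point interval at \<open>t\<close> guarantees that somebody is
    awake.\<close>
  using assms interval_rate_bounds by (intro bexI[of _ "(t, t)"]) (auto simp: active_rate_def)

lemma spec_alg_interval_online: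
  assumes "N \<ge> 1" "0 < L"
  shows "online_algorithm N T (spec_alg N ({1..T} \<times> {1..T}) (active_rate L))"
  by (rule spec_alg_online) (use assms active_rate_bounds ex_active_rate_pos in auto)

lemma spec_alg_interval_regret:
  assumes "N \<ge> 1" "0 < L" "ln (real N * real T ^ 2) \<le> L"
    and s: "payoff_seq N T s" and i: "i \<in> {1..N}" and ab: "1 \<le> a" "a \<le> b" "b \<le> T"
  shows "(\<Sum>j=a..b. s i j - alg_payoff N (spec_alg N ({1..T} \<times> {1..T}) (active_rate L) s) s j)
    \<le> 6 * sqrt (real (b - a + 1) * L)"
proof -
  let ?K = "{1..T} \<times> {1..T}"
  let ?A = "spec_alg N ?K (active_rate L)"
  define r where "r j = s i j - alg_payoff N (?A s) s j" for j
  define m where "m = real (b - a + 1)"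
  define \<eta> where "\<eta> = interval_rate L (a, b)"
  have m: "m \<ge> 1" "real (card {a..b}) = m" using ab by (auto simp: m_def)
  have r2: "\<bar>r j\<bar> \<le> 2" if "j \<in> {1..T}" for j
  proof -
    have s1: "\<bar>s i j\<bar> \<le> 1" if "i \<in> {1..N}" for i
      using s \<open>j \<in> {1..T}\<close> that by (auto simp: payoff_seq_def abs_le_iff minus_le_iff)
    have "prob_weights N (?A s j)"
      using spec_alg_interval_online[OF assms(1,2)] s that by (auto simp: online_algorithm_def)
    then have "\<bar>alg_payoff N (?A s) s j\<bar> \<le> 1" using s1 by (rule alg_payoff_bounds)
    with s1[OF i] show ?thesis unfolding r_def by linarith
  qed
  have "(\<Sum>j=a..b. r j) \<le> 6 * sqrt (m * L)"
  \<comment> \<open>On short intervals, where the rate is capped, the trivial regret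
    \<open>2 * m\<close> is already at most \<open>2 * sqrt (m * L)\<close>.\<close>
  proof (cases "m \<le> L")
    case True
    have "(\<Sum>j=a..b. r j) \<le> (\<Sum>j=a..b. 2)" by (rule sum_mono) (use r2 ab in \<open>auto simp: abs_le_iff\<close>)
    also have "\<dots> = 2 * sqrt (m * m)" using m by simp
    also have "\<dots> \<le> 6 * sqrt (m * L)"
      using True m by (intro mult_mono real_sqrt_le_mono mult_left_mono) auto
    finally show ?thesis .
  next
    case False
    then have \<eta>: "\<eta> = sqrt (L / m) / 4"
      using assms(2) m(1) by (simp add: \<eta>_def interval_rate_def min_def) (simp add: m_def)
    have b: "0 < \<eta>" "\<eta> \<le> 1/4" using interval_rate_bounds[OF assms(2)] by (auto simp: \<eta>_def)
    have inv: "(\<forall>i\<in>{1..N}. \<forall>k\<in>?K. 0 < spec_weight N ?K (active_rate L) s T i k) \<and>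
        (\<Sum>i=1..N. \<Sum>k\<in>?K. spec_weight N ?K (active_rate L) s T i k) = real (N * card ?K)"
      by (rule spec_weight_invariant[where T = T])
        (use assms(1,2) s active_rate_bounds ex_active_rate_pos in auto)
    \<comment> \<open>Outside [a, b] the rate is 0 and the factor is 1, so the product over the
      interval is the final weight of this specialist at time \<open>T\<close>, and the invariant is
      used only there.\<close>
    have "(\<Prod>j=a..b. 1 + \<eta> * r j) = (\<Prod>j=1..T. 1 + active_rate L j (a, b) * r j)"
      by (rule prod.mono_neutral_cong_left) (use ab in \<open>auto simp: active_rate_def \<eta>_def\<close>)
    also have "\<dots> = spec_weight N ?K (active_rate L) s T i (a, b)"
      by (simp add: spec_weight_eq_prod r_def)
    also have "\<dots> \<le> real (N * card ?K)"
      using inv i ab by (intro spec_weight_le) auto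
    also have "\<dots> = real N * real T ^ 2"
      by (simp add: card_cartesian_product power2_eq_square)
    finally have "(\<Sum>j=a..b. r j) \<le> ln (real N * real T ^ 2) / \<eta> + 8 * \<eta> * card {a..b}"
      using b r2 ab by (intro regret_le_of_prod_le) auto
    also have "\<dots> \<le> L / \<eta> + 8 * \<eta> * m"
      using b m assms(3) by (simp add: divide_right_mono)
    \<comment> \<open>The constant is 6 = 4 + 2: four from the logarithm of the total weight, two
      from the second-order error.\<close>
    also have "\<dots> = 6 * sqrt (m * L)"
    proof -
      have "L / \<eta> = 4 * sqrt (m * L)"
      proof -
        have "L = sqrt L * sqrt L" using assms(2) by simp
        then have "L / \<eta> = 4 * ((sqrt L * sqrt L) / (sqrt L / sqrt m))" by (simp add: \<eta> real_sqrt_divide)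
        then show ?thesis using assms(2) m by (simp add: real_sqrt_mult del: real_sqrt_mult_self)
      qed
      moreover have "8 * \<eta> * m = 2 * sqrt (m * L)"
      proof -
        have "m = sqrt m * sqrt m" using m by simp
        then have "8 * \<eta> * m = 2 * (sqrt L / sqrt m) * (sqrt m * sqrt m)" by (simp add: \<eta> real_sqrt_divide)
        then show ?thesis using m by (simp add: real_sqrt_mult del: real_sqrt_mult_self)
      qed
      ultimately show ?thesis by simp
    qed
    finally show ?thesis .
  qed
  then show ?thesis unfolding r_def m_def .
qed

section \<open>Choice of constants and conclusion\<close>

theorem theorem5:
  "\<exists>c c0 :: real. c > 0 \<and> c0 > 0 \<and>
     (\<forall>(N::nat) (T::nat) (Z::real). N \<ge> 1 \<longrightarrow> T \<ge> 2 \<longrightarrow> 0 < Z \<longrightarrow> Z \<le> c0 / (real N * real T) ^ 2 \<longrightarrow>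
       (\<exists>A. online_algorithm N T A \<and>
          (\<forall>s. payoff_seq N T s \<longrightarrow>
             (\<forall>i\<in>{1..N}. \<forall>n::real. n \<ge> 40 * ln (1 / Z) \<longrightarrow>
                Z_uniform c Z n T (\<lambda>t. s i t - alg_payoff N (A s) s t)))))"
proof (rule exI[of _ 6], rule exI[of _ 1], intro conjI allI impI)
  fix N T :: nat and Z :: real
  assume N: "N \<ge> 1" and T: "T \<ge> 2" and Z: "0 < Z" "Z \<le> 1 / (real N * real T) ^ 2"
  define L where "L = ln (1 / Z)"
  \<comment> \<open>The total weight is \<open>real N * real T ^ 2\<close>, at most the square of
    \<open>real N * real T\<close>. Hence \<open>c0\<close> = 1 suffices for its logarithm to be at
    most \<open>L\<close>.\<close>
  have NT: "real N * real T ^ 2 \<ge> 2 ^ 2" "real N * real T ^ 2 \<le> (real N * real T) ^ 2"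
  proof -
    have "1 * 2 ^ 2 \<le> real N * real T ^ 2" using N T by (intro mult_mono power_mono) auto
    then show "real N * real T ^ 2 \<ge> 2 ^ 2" by simp
    show "real N * real T ^ 2 \<le> (real N * real T) ^ 2"
      using N by (auto simp: power_mult_distrib intro!: mult_right_mono)
        (simp add: power2_eq_square)
  qed
  have "(real N * real T) ^ 2 \<le> 1 / Z"
    using Z N T by (simp add: field_simps)
  then have Z4: "real N * real T ^ 2 \<le> 1 / Z" using NT by linarith
  then have lnL: "ln (real N * real T ^ 2) \<le> L" unfolding L_def using NT by (intro ln_mono) auto
  have "4 \<le> 1 / Z" using NT Z4 by simp
  then have "Z \<le> 1 / 4" using Z by (simp add: field_simps)
  \<comment> \<open>From ln Z \<le> Z - 1 \<le> -3/4. With \<open>n\<close> at least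
    \<open>40 * L\<close> this gives \<open>n\<close> \<ge> 1, so the discount factor lies in
    [0, 1].\<close>
  then have L: "1 / 2 \<le> L" using ln_le_minus_one[OF Z(1)] Z by (simp add: L_def ln_div)
  let ?A = "spec_alg N ({1..T} \<times> {1..T}) (active_rate L)"
  show "\<exists>A. online_algorithm N T A \<and> (\<forall>s. payoff_seq N T s \<longrightarrow>
      (\<forall>i\<in>{1..N}. \<forall>n::real. n \<ge> 40 * ln (1 / Z) \<longrightarrow>
        Z_uniform 6 Z n T (\<lambda>t. s i t - alg_payoff N (A s) s t)))"
  proof (intro exI[of _ ?A] conjI allI impI ballI)
    show "online_algorithm N T ?A" using N L by (intro spec_alg_interval_online) auto
  next
    fix s i and n :: real
    assume s: "payoff_seq N T s" and i: "i \<in> {1..N}" and "n \<ge> 40 * ln (1 / Z)"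
    then have n: "n \<ge> 1" using L by (simp add: L_def)
    show "Z_uniform 6 Z n T (\<lambda>t. s i t - alg_payoff N (?A s) s t)"
      \<comment> \<open>For each \<open>t\<close> the interval bound is applied to every final
        segment [a, t] of [1, t], always with the constant 6.\<close>
      unfolding Z_uniform_def L_def[symmetric]
      using n L N lnL s i
      by (intro ballI discounted_sum_sqrt_le spec_alg_interval_regret) auto
  qed
qed auto

end
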